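(* Let $X\subset\{0,1,2,3,4\}^{\mathbb{N}}$ be the subshift encoding ill-founded trees that is defined in the context, with the shift map $\sigma|_X:X\to X$, and let $\omega_0=(3,4,0,0,0,\ldots)=3\,4\,0^\infty\in X$. Then the special $\alpha$-limit set $s\alpha(\omega_0)\subset X$ of $\omega_0$ in the dynamical system $(X,\sigma|_X)$ is $\boldsymbol{\Sigma}^1_1$-complete.
   Context: Words and trees. $\mathbb{N}=\{0,1,2,\ldots\}$. $\mathbb{N}^{<\mathbb{N}}$ is the set of all finite words $s=(s_0,\ldots,s_{n-1})$ over $\mathbb{N}$, including the empty word. For a finite or infinite word $s$ and $n\le \mathrm{len}(s)$, $s|n=(s_0,\ldots,s_{n-1})$ is its initial segment of length $n$. For a finite word $s$ and a finite or infinite word $t$, the juxtaposition $s\,t$ denotes their concatenation. For a symbol $a$, $a^n$ is the word consisting of $n$ copies of $a$, and $a^\infty$ is the constant infinite word $(a,a,\ldots)$. A tree is a set $T\subseteq\mathbb{N}^{<\mathbb{N}}$ closed under taking initial segments. An infinite branch of $T$ is an infinite word $y=(y_0,y_1,\ldots)\in\mathbb{N}^{\mathbb{N}}$ with $y|n\in T$ for all $n\in\mathbb{N}$. A tree is ill-founded if it has an infinite branch. Let $R$ be the set of all pairs $(T,y)$ where $T$ is an ill-founded tree and $y$ is an infinite branch of $T$. The subshift $X$. Fix an enumeration (bijective) $(s_i)_{i\in\mathbb{N}}$ of $\mathbb{N}^{<\mathbb{N}}$. For $T\subseteq\mathbb{N}^{<\mathbb{N}}$ let $h(T)\in\{0,1\}^{\mathbb{N}}$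 be the sequence $x$ with $x_i=1$ if $s_i\in T$ and $x_i=0$ if $s_i\notin T$. Give $\{0,1,2,3,4\}^{\mathbb{N}}$ the product topology (of discrete spaces) and let $\sigma$ be the shift, $(\sigma x)_i=x_{i+1}$. For $(T,y)\in R$, with $x=h(T)$, define inductively (all juxtapositions being concatenations of words) $$\omega_0(T,y)=3\,4\,0^\infty,\qquad \omega_n(T,y)=3\,(x|n)\,2^{\,n+y_{n-1}}\,\omega_{n-1}(T,y)\quad (n\ge 1),$$ where $2^{\,n+y_{n-1}}$ means the symbol $2$ repeated $n+y_{n-1}$ times. Then $$X=\{0,1,2,3\}^{\mathbb{N}}\cup\{\sigma^j(\omega_i(T,y)) : (T,y)\in R,\ i,j\in\mathbb{N}\}.$$ $X$ is a closed subset of $\{0,1,2,3,4\}^{\mathbb{N}}$ with $\sigma(X)\subseteq X$, and it carries the subspace topology. Special $\alpha$-limit sets. For a continuous map $f:Y\to Y$ of a compact metrizable space, a backward orbit of $x\in Y$ is a sequence $(x_n)_{n\in\mathbb{N}}$ in $Y$ with $x_0=x$ and $f(x_{n+1})=x_n$ for all $n$. The special $\alpha$-limit set $s\alpha(x)$ is the union, over all backward orbits $(x_n)$ of $x$, of the set of accumulation points of $(x_n)$ (limits of $x_{n_i}$ along subsequences $n_i\to\infty$). Descriptive set theory. A subset $B$ of a Polish space $Y$ is analytic ($\boldsymbol{\Sigma}^1_1$) if there exist a Polish space $Z$, a Borel subset $A\subset Z$, and a continuous map $g:Z\to Y$ with $B=g(A)$. Here, a set is called $\boldsymbol{\Sigma}^1_1$-complete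 if it is analytic but not Borel. *)

theory Defs
  imports "HOL-Analysis.Analysis" "HOL-Library.Omega_Words_Fun"
begin

section \<open>Analytic and Borel sets\<close>

definition borel_sets_of :: "'a topology \<Rightarrow> 'a set set" where
  "borel_sets_of Y = sigma_sets (topspace Y) {U. openin Y U}"

definition polish :: "'a topology \<Rightarrow> bool" where
  "polish Y \<longleftrightarrow> completely_metrizable_space Y \<and> second_countable Y"

text \<open>
  HOL cannot quantify over all types inside a formula, so the auxiliary Polish space Z ranges over
  the topologies whose carrier is some subset of the type nat => nat. This is no restriction, since
  a Polish space has at most continuum many points; see the lemma analytic_inI below.
\<close>

definition analytic_in :: "'a topology \<Rightarrow> 'a set \<Rightarrow> bool" where
  "analytic_in Y B \<longleftrightarrow>
     (\<exists>(Z :: (nat \<Rightarrow> nat) topology) A g.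
        polish Z \<and> A \<in> borel_sets_of Z \<and> continuous_map Z Y g \<and> B = g ` A)"

definition Sigma11_complete :: "'a topology \<Rightarrow> 'a set \<Rightarrow> bool" where
  "Sigma11_complete Y B \<longleftrightarrow> analytic_in Y B \<and> B \<notin> borel_sets_of Y"

lemma borel_sets_of_vimage:
  assumes g: "continuous_map Z' Z g" and A: "A \<in> borel_sets_of Z"
  shows "topspace Z' \<inter> g -` A \<in> borel_sets_of Z'"
  using A unfolding borel_sets_of_def
proof (induction rule: sigma_sets.induct)
  case (Basic U)
  then have "openin Z' {x \<in> topspace Z'. g x \<in> U}"
    using g openin_continuous_map_preimage by blast
  moreover have "{x \<in> topspace Z'. g x \<in> U} = topspace Z' \<inter> g -` U" by auto
  ultimately show ?case by (auto intro: sigma_sets.Basic)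
next
  case Empty
  then show ?case by (simp add: sigma_sets.Empty)
next
  case (Compl U)
  have "topspace Z' \<inter> g -` (topspace Z - U) = topspace Z' - (topspace Z' \<inter> g -` U)"
    using g by (auto simp: continuous_map_def)
  then show ?case using Compl.IH by (simp add: sigma_sets.Compl)
next
  case (Union U)
  have eq: "topspace Z' \<inter> g -` (\<Union>i. U i) = (\<Union>i. topspace Z' \<inter> g -` U i)" by auto
  show ?case unfolding eq by (rule sigma_sets.Union) (rule Union.IH)
qed

lemma polish_inj_nat_fun:
  fixes Z :: "'z topology"
  assumes "polish Z"
  obtains e :: "'z \<Rightarrow> nat \<Rightarrow> nat" where "inj_on e (topspace Z)"
proof -
  obtain \<B> where \<B>: "countable \<B>"
      "\<And>U x. openin Z U \<Longrightarrow> x \<in> U \<Longrightarrow> \<exists>V\<in>\<B>. x \<in> V \<and> V \<subseteq> U"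
    using assms unfolding polish_def second_countable_def by metis
  have "t0_space Z"
    using assms
    by (simp add: polish_def completely_metrizable_imp_metrizable_space
        metrizable_imp_Hausdorff_space Hausdorff_imp_t1_space t1_imp_t0_space)
  define e :: "'z \<Rightarrow> nat \<Rightarrow> nat" where
    "e x n = (if x \<in> from_nat_into \<B> n then 1 else 0)" for x n
  have "inj_on e (topspace Z)"
  proof (rule inj_onI, rule ccontr)
    fix x y assume xy: "x \<in> topspace Z" "y \<in> topspace Z" "e x = e y" "x \<noteq> y"
    have same: "x \<in> V \<longleftrightarrow> y \<in> V" if V: "V \<in> \<B>" for V
    proof -
      obtain n where n: "from_nat_into \<B> n = V" using \<B>(1) V by (meson from_nat_into_surj)
      have "e x n = e y n" using xy by simp
      then show ?thesis unfolding e_def n by (simp split: if_splits)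
    qed
    obtain U where "openin Z U" "x \<in> U \<longleftrightarrow> y \<notin> U"
      using \<open>t0_space Z\<close> xy unfolding t0_space_def by blast
    then show False using \<B>(2) same by blast
  qed
  then show thesis by (rule that)
qed

lemma analytic_inI:
  fixes Z :: "'z topology"
  assumes Z: "polish Z" and A: "A \<in> borel_sets_of Z" and g: "continuous_map Z Y g"
  shows "analytic_in Y (g ` A)"
proof -
  obtain e :: "'z \<Rightarrow> nat \<Rightarrow> nat" where e: "inj_on e (topspace Z)"
    using polish_inj_nat_fun[OF Z] by blast
  define d where "d = inv_into (topspace Z) e"
  define Z' where "Z' = pullback_topology (e ` topspace Z) d Z"
  have de: "d (e x) = x" if "x \<in> topspace Z" for x
    using e that by (simp add: d_def)
  have top: "topspace Z' = e ` topspace Z"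
    by (auto simp: Z'_def topspace_pullback_topology de)
  have d: "continuous_map Z' Z d"
    using continuous_map_pullback[OF continuous_map_id, of _ d Z]
    unfolding Z'_def by (simp add: id_def comp_def)
  have ecm: "continuous_map Z Z' e"
    unfolding Z'_def
  proof (rule continuous_map_pullback')
    show "continuous_map Z Z (d \<circ> e)"
      by (rule continuous_map_eq[OF continuous_map_id]) (simp add: de)
    show "topspace Z \<subseteq> e -` (e ` topspace Z)" by auto
  qed
  have hom: "Z homeomorphic_space Z'"
    unfolding homeomorphic_space_def homeomorphic_maps_def
    by (rule exI[of _ e], rule exI[of _ d]) (use d ecm in \<open>auto simp: de top\<close>)
  have "polish Z'"
    using Z homeomorphic_completely_metrizable_space[OF hom]
      homeomorphic_space_second_countability[OF hom]
    by (simp add: polish_def)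
  moreover have "topspace Z' \<inter> d -` A \<in> borel_sets_of Z'"
    by (rule borel_sets_of_vimage[OF d A])
  moreover have "continuous_map Z' Y (g \<circ> d)"
    by (rule continuous_map_compose[OF d g])
  moreover have "g ` A = (g \<circ> d) ` (topspace Z' \<inter> d -` A)"
  proof -
    have "{U. openin Z U} \<subseteq> Pow (topspace Z)" by (auto dest: openin_subset)
    then have "A \<subseteq> topspace Z"
      using A sigma_sets_into_sp unfolding borel_sets_of_def by blast
    then have "d ` (topspace Z' \<inter> d -` A) = A" by (force simp: top de image_iff)
    then show ?thesis by (metis image_comp)
  qed
  ultimately show ?thesis unfolding analytic_in_def by blast
qed


section \<open>Special alpha-limit sets\<close>

definition backward_orbit :: "'a topology \<Rightarrow> ('a \<Rightarrow> 'a) \<Rightarrow> 'a \<Rightarrow> (nat \<Rightarrow> 'a) \<Rightarrow> bool" where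
  "backward_orbit Y f x u \<longleftrightarrow>
     (\<forall>n. u n \<in> topspace Y) \<and> u 0 = x \<and> (\<forall>n. f (u (Suc n)) = u n)"

definition accumulation_points :: "'a topology \<Rightarrow> (nat \<Rightarrow> 'a) \<Rightarrow> 'a set" where
  "accumulation_points Y u =
     {z. \<exists>r :: nat \<Rightarrow> nat. strict_mono r \<and> limitin Y (u \<circ> r) z sequentially}"

definition special_alpha_limit :: "'a topology \<Rightarrow> ('a \<Rightarrow> 'a) \<Rightarrow> 'a \<Rightarrow> 'a set" where
  "special_alpha_limit Y f x = (\<Union>u \<in> {u. backward_orbit Y f x u}. accumulation_points Y u)"


section \<open>Trees\<close>

text \<open>
  Finite words are lists and infinite words are functions on nat, so that prefix n y and the
  concatenation of a finite with an infinite word are those of the theory Omega_Words_Fun.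
\<close>

definition is_tree :: "nat list set \<Rightarrow> bool" where
  "is_tree T \<longleftrightarrow> (\<forall>t\<in>T. \<forall>n\<le>length t. take n t \<in> T)"

definition infinite_branch :: "nat list set \<Rightarrow> (nat \<Rightarrow> nat) \<Rightarrow> bool" where
  "infinite_branch T y \<longleftrightarrow> (\<forall>n. prefix n y \<in> T)"

definition ill_founded :: "nat list set \<Rightarrow> bool" where
  "ill_founded T \<longleftrightarrow> (\<exists>y. infinite_branch T y)"

definition tree_branch_pairs :: "(nat list set \<times> (nat \<Rightarrow> nat)) set" where
  "tree_branch_pairs = {(T, y). is_tree T \<and> ill_founded T \<and> infinite_branch T y}"


section \<open>The subshift\<close>

text \<open>
  Symbols are natural numbers. The type nat is discrete and nat => nat carries the product topology,
  so the sequences over {0,...,4} form a subset whose subspace topology is the product topology.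
  The parameter s is the chosen enumeration of all finite words.
\<close>

definition shift :: "(nat \<Rightarrow> nat) \<Rightarrow> nat \<Rightarrow> nat" where
  "shift x = (\<lambda>i. x (i + 1))"

definition encode :: "(nat \<Rightarrow> nat list) \<Rightarrow> nat list set \<Rightarrow> nat \<Rightarrow> nat" where
  "encode s T = (\<lambda>i. if s i \<in> T then 1 else 0)"

definition omega0 :: "nat \<Rightarrow> nat" where
  "omega0 = [3, 4] \<frown> (\<lambda>_. 0)"

primrec omega :: "(nat \<Rightarrow> nat list) \<Rightarrow> nat list set \<Rightarrow> (nat \<Rightarrow> nat) \<Rightarrow> nat \<Rightarrow> (nat \<Rightarrow> nat)" where
  "omega s T y 0 = omega0"
| "omega s T y (Suc n) =
     ([3] @ prefix (Suc n) (encode s T) @ replicate (Suc n + y n) 2) \<frown> omega s T y n"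

definition subshift :: "(nat \<Rightarrow> nat list) \<Rightarrow> (nat \<Rightarrow> nat) set" where
  "subshift s = {w. range w \<subseteq> {0, 1, 2, 3}} \<union>
     {(shift ^^ j) (omega s T y i) | T y i j. (T, y) \<in> tree_branch_pairs}"

lemma shift_funpow: "(shift ^^ j) w = (\<lambda>n. w (n + j))"
proof (induction j)
  case (Suc j)
  then have "(shift ^^ Suc j) w = shift (\<lambda>n. w (n + j))" by simp
  also have "\<dots> = (\<lambda>n. w (n + Suc j))" by (simp add: shift_def)
  finally show ?case .
qed simp

lemma subshift_cases:
  assumes "x \<in> subshift s"
  obtains "range x \<subseteq> {0, 1, 2, 3}"
  | T y i j where "(T, y) \<in> tree_branch_pairs" "x = (shift ^^ j) (omega s T y i)"
  using assms unfolding subshift_def by (elim UnE CollectE exE conjE)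

lemma subshiftI:
  assumes "(T, y) \<in> tree_branch_pairs"
  shows "(shift ^^ j) (omega s T y i) \<in> subshift s"
  unfolding subshift_def
  by (rule UnI2, rule CollectI, (rule exI)+, rule conjI[OF refl assms])

lemma shift_subshift: "shift ` subshift s \<subseteq> subshift s"
proof (rule image_subsetI)
  fix w assume "w \<in> subshift s"
  then show "shift w \<in> subshift s"
  proof (cases rule: subshift_cases)
    case 1
    have "range (shift w) \<subseteq> range w" by (auto simp: shift_def)
    also note 1
    finally show ?thesis by (simp add: subshift_def)
  next
    case (2 T y i j)
    then have "shift w = (shift ^^ Suc j) (omega s T y i)" by simp
    then show ?thesis using subshiftI[OF 2(1)] by metis
  qed
qed

lemma continuous_map_shift:
  "continuous_map (top_of_set (subshift s)) (top_of_set (subshift s)) shift"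
proof -
  have "continuous_on UNIV shift"
    unfolding shift_def
    by (intro continuous_on_coordinatewise_then_product continuous_on_product_coordinates)
  then show ?thesis
    using shift_subshift by (auto intro: continuous_on_subset)
qed

lemma omega0_in_subshift: "omega0 \<in> subshift s"
proof -
  have "(UNIV, \<lambda>_. 0) \<in> tree_branch_pairs"
    by (auto simp: tree_branch_pairs_def is_tree_def ill_founded_def infinite_branch_def)
  moreover have "omega0 = (shift ^^ 0) (omega s UNIV (\<lambda>_. 0) 0)" by simp
  ultimately show ?thesis using subshiftI by metis
qed

lemma omega_form:
  obtains v where "omega s T y i = (v @ [4]) \<frown> (\<lambda>_. 0)" "set v \<subseteq> {0, 1, 2, 3}"
proof -
  have "\<exists>v. omega s T y i = (v @ [4]) \<frown> (\<lambda>_. 0) \<and> set v \<subseteq> {0, 1, 2, 3}"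
  proof (induction i)
    case 0
    show ?case by (rule exI[of _ "[3]"]) (simp add: omega0_def)
  next
    case (Suc i)
    then obtain v where v: "omega s T y i = (v @ [4]) \<frown> (\<lambda>_. 0)" "set v \<subseteq> {0, 1, 2, 3}"
      by blast
    let ?u = "[3] @ prefix (Suc i) (encode s T) @ replicate (Suc i + y i) 2"
    have "set (prefix (Suc i) (encode s T)) \<subseteq> {0, 1}"
      by (auto simp: subsequence_def encode_def)
    then have "set (?u @ v) \<subseteq> {0, 1, 2, 3}" using v(2) by auto
    moreover have "omega s T y (Suc i) = ((?u @ v) @ [4]) \<frown> (\<lambda>_. 0)"
      by (simp only: omega.simps v(1) conc_conc append_assoc)
    ultimately show ?case by blast
  qed
  then show thesis using that by blast
qed

lemma subshift_after_4:
  assumes "x \<in> subshift s" "x p = 4" "q > p"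
  shows "x q = 0"
proof -
  have "4 \<in> range x" using assms(2) by (metis rangeI)
  then have "\<not> range x \<subseteq> {0, 1, 2, 3}" by auto
  then obtain T y i j where x: "x = (shift ^^ j) (omega s T y i)"
    using subshift_cases[OF assms(1)] by metis
  obtain v where v: "omega s T y i = (v @ [4]) \<frown> (\<lambda>_. 0)" "set v \<subseteq> {0, 1, 2, 3}"
    by (rule omega_form)
  have "p + j \<ge> length v"
  proof (rule ccontr)
    assume *: "\<not> p + j \<ge> length v"
    then have "x p = v ! (p + j)"
      by (simp add: x shift_funpow v(1) conc_def nth_append)
    then have "4 \<in> set v" using * assms(2) by (metis not_le nth_mem)
    then show False using v(2) by auto
  qed
  then show ?thesis using \<open>q > p\<close> by (simp add: x shift_funpow v(1) conc_def)
qed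

lemma range_subshift:
  assumes "x \<in> subshift s"
  shows "range x \<subseteq> {0, 1, 2, 3, 4}"
  using assms
proof (cases rule: subshift_cases)
  case 1
  then show ?thesis by auto
next
  case (2 T y i j)
  obtain v where v: "omega s T y i = (v @ [4]) \<frown> (\<lambda>_. 0)" "set v \<subseteq> {0, 1, 2, 3}"
    by (rule omega_form)
  have "range x \<subseteq> range (omega s T y i)" by (auto simp: 2(2) shift_funpow)
  also have "range (omega s T y i) = insert 4 (insert 0 (set v))"
    unfolding v(1) by (subst range_conc) auto
  also have "\<dots> \<subseteq> {0, 1, 2, 3, 4}" using v(2) by auto
  finally show ?thesis .
qed

lemma closed_subshift: "closed (subshift s)"
proof -
  have "w \<in> subshift s" if w: "w \<in> closure (subshift s)" for w
  proof -
    have approx: "\<exists>x \<in> subshift s. \<forall>k\<le>n. x k = w k" for n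
    proof -
      have "open {x :: nat \<Rightarrow> nat. \<forall>k\<in>{..n}. x (id k) \<in> {w k}}"
        by (rule product_topology_basis') (auto simp: open_discrete)
      then have "open {x :: nat \<Rightarrow> nat. \<forall>k\<le>n. x k = w k}" by (simp add: Ball_def)
      then show ?thesis using w unfolding closure_iff_nhds_not_empty by blast
    qed
    show ?thesis
    proof (cases "\<exists>p. w p = 4")
      case False
      have "range w \<subseteq> {0, 1, 2, 3}"
      proof
        fix a assume "a \<in> range w"
        then obtain n where n: "a = w n" by blast
        obtain x where "x \<in> subshift s" "x n = w n" using approx[of n] by blast
        then have "a \<in> {0, 1, 2, 3, 4}" using range_subshift n by (metis rangeI subsetD)
        then show "a \<in> {0, 1, 2, 3}" using False n by auto
      qed
      then show ?thesis unfolding subshift_def by blast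
    next
      case True
      then obtain p where p: "w p = 4" by blast
      obtain x where x: "x \<in> subshift s" "\<And>k. k \<le> p \<Longrightarrow> x k = w k" using approx[of p] by blast
      have "x q = w q" for q
      proof (cases "q \<le> p")
        case False
        obtain x' where x': "x' \<in> subshift s" "\<forall>k\<le>q. x' k = w k" using approx[of q] by blast
        then have "w q = 0" using subshift_after_4[of x' s p q] p False by auto
        moreover have "x q = 0" using subshift_after_4[of x s p q] x p False by auto
        ultimately show ?thesis by simp
      qed (simp add: x)
      then have "x = w" by blast
      then show ?thesis using x(1) by simp
    qed
  qed
  then show ?thesis by (metis closure_subset_eq subsetI)
qed

lemma euclidean_nat: "(euclidean :: nat topology) = discrete_topology UNIV"
  unfolding topology_eq openin_discrete_topology by (simp add: open_discrete)

lemma polish_subshift: "polish (top_of_set (subshift s))"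
  unfolding polish_def
proof
  have "completely_metrizable_space (euclidean :: nat topology)"
    using completely_metrizable_space_discrete_topology[of "UNIV :: nat set"]
    by (simp add: euclidean_nat)
  then have "completely_metrizable_space (euclidean :: (nat \<Rightarrow> nat) topology)"
    by (simp add: completely_metrizable_space_product_topology flip: euclidean_product_topology)
  then show "completely_metrizable_space (top_of_set (subshift s))"
    by (rule completely_metrizable_space_closedin) (rule closed_subshift[unfolded closed_closedin])
  obtain B :: "(nat \<Rightarrow> nat) set set" where B: "countable B" "\<And>C. C \<in> B \<Longrightarrow> open C"
      "\<And>S. open S \<Longrightarrow> \<exists>U. U \<subseteq> B \<and> S = \<Union>U"
    by (rule univ_second_countable, rule that, assumption, blast, blast)
  have "second_countable (euclidean :: (nat \<Rightarrow> nat) topology)"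
    unfolding second_countable_def
  proof (intro exI conjI ballI allI impI)
    show "countable B" by (rule B)
    show "openin euclidean V" if "V \<in> B" for V using B(2) that by simp
    fix U and x :: "nat \<Rightarrow> nat" assume "openin euclidean U \<and> x \<in> U"
    then show "\<exists>V\<in>B. x \<in> V \<and> V \<subseteq> U" using B(3)[of U] by auto
  qed
  then show "second_countable (top_of_set (subshift s))"
    by (rule second_countable_subtopology)
qed

end

theory Submission
  imports Defs
begin

text \<open>
  The set is analytic because a point z lies in it iff some backward orbit returns to every basic
  neighbourhood of z infinitely often, which is a Borel condition on z and the orbit.

  It is not Borel because a word 3 x without further 3's, where x encodes a tree T, lies in it iff
  T is ill-founded: the positions of the symbol 3 along a backward orbit determine the numbers
  y 0, y 1, ..., so the pairs in R met along the orbit agree on longer and longer pieces of a single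
  word y, which is then a branch of T. If the ill-founded trees were Borel, then so would be the set
  of all c that belong to the analytic set coded by c; its complement would be a projection of a
  closed set and hence have a code itself, which Cantor's diagonal argument refutes.
\<close>

section \<open>The positions of the symbol 3\<close>

text \<open>The length of the word in front of the final \<open>omega0\<close> in
  \<open>omega s T y k\<close>, hence the only time at which a backward orbit of
  \<open>omega0\<close> can be at that word. Each summand is the length of one block: tree digits,
  twos and the leading 3.\<close>

primrec block_start :: "(nat \<Rightarrow> nat) \<Rightarrow> nat \<Rightarrow> nat" where
  "block_start y 0 = 0"
| "block_start y (Suc k) = block_start y k + (Suc k + (Suc k + y k) + 1)"

lemma strict_mono_block_start: "strict_mono (block_start y)"
  by (simp add: strict_mono_Suc_iff)

lemma omega_Suc_nth:
  "omega s T y (Suc k) n =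
     (if n = 0 then 3
      else if n \<le> Suc k then encode s T (n - 1)
      else if n < Suc k + (Suc k + y k) + 1 then 2
      else omega s T y k (n - (Suc k + (Suc k + y k) + 1)))"
  by (auto simp: conc_def nth_append nth_Cons' simp del: subseq_to_Suc)

declare omega.simps(2) [simp del]

lemma omega_prefix:
  assumes "n \<le> k"
  shows "omega s T y k n = (if n = 0 then 3 else encode s T (n - 1))"
  using assms by (cases k) (auto simp: omega_Suc_nth omega0_def)

lemma shift_omega:
  assumes "i \<le> k"
  shows "(shift ^^ (block_start y k - block_start y i)) (omega s T y k) = omega s T y i"
  using assms
proof (induction k rule: dec_induct)
  case (step k)
  have *: "block_start y i \<le> block_start y k"
    using step.hyps strict_mono_less_eq[OF strict_mono_block_start] by blast
  show ?case
    unfolding step.IH[symmetric] shift_funpow using *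
    by (auto simp: omega_Suc_nth fun_eq_iff)
qed simp

text \<open>Tree digits are 0 or 1 and the padding is 2, so a 3 occurs only at the head of a block.
  Positions are counted back from the 3 of \<open>omega0\<close>, so a new block in front leaves the
  old ones unchanged.\<close>

lemma omega_eq_3_iff:
  assumes "p \<le> block_start y k"
  shows "omega s T y k (block_start y k - p) = 3 \<longleftrightarrow> (\<exists>i\<le>k. p = block_start y i)"
  using assms
proof (induction k)
  case 0
  then show ?case by (simp add: omega0_def)
next
  case (Suc k)
  have mono: "i \<le> k \<Longrightarrow> block_start y i \<le> block_start y k" for i
    using strict_mono_less_eq[OF strict_mono_block_start] by blast
  show ?case
  proof (cases "p \<le> block_start y k")
    case True
    have "omega s T y (Suc k) (block_start y (Suc k) - p) = omega s T y k (block_start y k - p)"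
      using True by (simp add: omega_Suc_nth Suc_diff_le) arith
    then show ?thesis using Suc.IH[OF True] True by (auto simp: le_Suc_eq)
  next
    case False
    then have "(\<exists>i\<le>Suc k. p = block_start y i) \<longleftrightarrow> p = block_start y (Suc k)"
      using mono by (auto simp: le_Suc_eq)
    moreover have "omega s T y (Suc k) (block_start y (Suc k) - p) = 3 \<longleftrightarrow> p = block_start y (Suc k)"
      using False Suc.prems
      by (auto simp: omega_Suc_nth encode_def)
    ultimately show ?thesis by simp
  qed
qed

lemma omega_eq_4_iff: "omega s T y k n = 4 \<longleftrightarrow> n = Suc (block_start y k)"
proof (induction k arbitrary: n)
  case 0
  show ?case by (auto simp: omega0_def conc_def nth_Cons')
next
  case (Suc k)
  show ?case by (auto simp: omega_Suc_nth Suc.IH encode_def)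
qed

section \<open>Backward orbits\<close>

lemma backward_orbit_shift:
  assumes "backward_orbit Y shift x u"
  shows "(shift ^^ m) (u (m + n)) = u n"
proof (induction m)
  case (Suc m)
  have "(shift ^^ Suc m) (u (Suc m + n)) = (shift ^^ m) (shift (u (Suc (m + n))))"
    by (simp add: funpow_swap1)
  then show ?case using assms Suc by (simp add: backward_orbit_def)
qed simp

text \<open>Orbit points keep the 4 of \<open>omega0\<close>, so they lie outside the full shift on
  four symbols and are shifts of some \<open>omega\<close>. Matching the 4 fixes the amount of the
  shift, and the leading 3 puts the point at the head of a block.\<close>

lemma backward_orbit_block:
  assumes u: "backward_orbit (top_of_set (subshift s)) shift omega0 u" and 3: "u n 0 = 3"
  obtains k T y where "(T, y) \<in> tree_branch_pairs" "u n = omega s T y k" "n = block_start y k"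
proof -
  have "(shift ^^ n) (u n) = omega0"
    using backward_orbit_shift[OF u, of n 0] u by (simp add: backward_orbit_def)
  \<comment> \<open>The 4 stands at index 1 of \<open>omega0\<close>, hence at index
    \<open>n + 1\<close> of \<open>u n\<close>.\<close>
  then have 4: "u n (Suc n) = 4"
    by (auto simp: shift_funpow omega0_def conc_def fun_eq_iff dest!: spec[of _ 1])
  have "\<not> range (u n) \<subseteq> {0, 1, 2, 3}"
  proof
    assume "range (u n) \<subseteq> {0, 1, 2, 3}"
    then have "u n (Suc n) \<in> {0, 1, 2, 3}" by blast
    then show False using 4 by simp
  qed
  moreover have "u n \<in> subshift s" using u by (simp add: backward_orbit_def)
  ultimately obtain T y i j where T: "(T, y) \<in> tree_branch_pairs"
    and un: "u n = (shift ^^ j) (omega s T y i)"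
    by (meson subshift_cases)
  have "omega s T y i (Suc n + j) = 4" using 4 by (simp add: un shift_funpow)
  then have n: "n + j = block_start y i" unfolding omega_eq_4_iff by simp
  then have "omega s T y i (block_start y i - n) = 3"
    using 3 by (simp add: un shift_funpow flip: n)
  then obtain k where k: "k \<le> i" "n = block_start y k" using omega_eq_3_iff[of n y i s T] n by auto
  have "j = block_start y i - block_start y k" using n k by simp
  then have "u n = omega s T y k" using shift_omega[OF k(1)] un by simp
  then show thesis using that T k(2) by blast
qed

text \<open>The left side refers to the orbit only, which allows comparing the block starts of
  different pairs met by one orbit.\<close>

lemma backward_orbit_eq_3_iff:
  assumes u: "backward_orbit Y shift x u"
    and v: "u (block_start y l) = omega s T y l" and "n \<le> block_start y l"
  shows "u n 0 = 3 \<longleftrightarrow> (\<exists>i\<le>l. n = block_start y i)"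
proof -
  have "u n = (shift ^^ (block_start y l - n)) (omega s T y l)"
    using backward_orbit_shift[OF u, of "block_start y l - n" n] assms(3) v by simp
  then show ?thesis using omega_eq_3_iff[OF assms(3)] by (simp add: shift_funpow)
qed

text \<open>Both sequences of block starts enumerate in increasing order the times with a leading 3,
  up to the earlier block. The induction carries \<open>i \<le> l\<close> because the description of
  these times through \<open>y'\<close> covers the starts up to \<open>l\<close> only.\<close>

lemma block_start_determined:
  assumes u: "backward_orbit Y shift x u"
    and v: "u (block_start y k) = omega s T y k" "u (block_start y' l) = omega s T' y' l"
    and le: "block_start y k \<le> block_start y' l" and "i \<le> k"
  shows "i \<le> l \<and> block_start y i = block_start y' i"
  using \<open>i \<le> k\<close>
proof (induction i)
  case (Suc i)
  note less_eq = strict_mono_less_eq[OF strict_mono_block_start]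
    and less = strict_mono_less[OF strict_mono_block_start]
  have IH: "i \<le> l" "block_start y i = block_start y' i" using Suc by auto
  have "block_start y' i < block_start y' l"
    using Suc.prems le IH(2) less[of y i k] by simp
  then have il: "Suc i \<le> l" using less[of y'] by simp
  have ik: "block_start y (Suc i) \<le> block_start y k"
    using Suc.prems less_eq by blast
  then have "u (block_start y (Suc i)) 0 = 3"
    using backward_orbit_eq_3_iff[OF u v(1)] Suc.prems by blast
  \<comment> \<open>The next start for \<open>y\<close> is also a start for \<open>y'\<close> with
    an index beyond \<open>i\<close>, so the next start for \<open>y'\<close> comes no later; the
    reverse comparison is symmetric.\<close>
  then obtain i' where i': "block_start y (Suc i) = block_start y' i'"
    using backward_orbit_eq_3_iff[OF u v(2)] ik le by (meson le_trans)
  have "block_start y' i < block_start y' i'"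
    using IH(2) i' less[of y i "Suc i"] by simp
  then have "Suc i \<le> i'" using less[of y'] by simp
  then have ge: "block_start y' (Suc i) \<le> block_start y (Suc i)" by (simp only: i' less_eq)
  have "u (block_start y' (Suc i)) 0 = 3"
    using backward_orbit_eq_3_iff[OF u v(2)] il less_eq by blast
  then obtain i'' where i'': "block_start y' (Suc i) = block_start y i''"
    using backward_orbit_eq_3_iff[OF u v(1)] ik ge by (meson le_trans)
  have "block_start y i < block_start y i''"
    using IH(2) i'' less[of y' i "Suc i"] by simp
  then have "Suc i \<le> i''" using less[of y] by simp
  then have "block_start y (Suc i) \<le> block_start y' (Suc i)" by (simp only: i'' less_eq)
  with ge il show ?case by simp
qed simp

text \<open>The gap between the block starts \<open>i\<close> and \<open>i + 1\<close> is
  \<open>2 * i + 3 + y i\<close>, so the starts determine the entries of \<open>y\<close>.\<close>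

lemma branch_determined:
  assumes u: "backward_orbit Y shift x u"
    and v: "u (block_start y k) = omega s T y k" "u (block_start y' l) = omega s T' y' l"
    and le: "block_start y k \<le> block_start y' l" and "i < k"
  shows "y i = y' i"
  using block_start_determined[OF u v le, of i] block_start_determined[OF u v le, of "Suc i"] \<open>i < k\<close>
  by simp

section \<open>Accumulation points\<close>

text \<open>Convergence in a product of discrete spaces is eventual agreement in each coordinate.
  The right side quantifies only over natural numbers, which later makes the condition
  Borel.\<close>

lemma accumulation_points_iff:
  fixes u :: "nat \<Rightarrow> nat \<Rightarrow> nat"
  assumes u: "range u \<subseteq> S"
  shows "z \<in> accumulation_points (top_of_set S) u \<longleftrightarrow>
    z \<in> S \<and> (\<forall>k N. \<exists>n\<ge>N. \<forall>i<k. u n i = z i)"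
proof -
  have lim: "limitin (top_of_set S) (u \<circ> r) z sequentially \<longleftrightarrow>
      z \<in> S \<and> (\<forall>i. \<forall>\<^sub>F n in sequentially. u (r n) i = z i)" for r
  proof -
    have "limitin (top_of_set S) (u \<circ> r) z sequentially \<longleftrightarrow>
        z \<in> S \<and> limitin (product_topology (\<lambda>_. euclidean) UNIV) (u \<circ> r) z sequentially"
      using u by (auto simp: limitin_subtopology euclidean_product_topology intro!: always_eventually)
    then show ?thesis
      by (simp add: limitin_componentwise tendsto_discrete)
  qed
  show ?thesis
  proof safe
    assume "z \<in> accumulation_points (top_of_set S) u"
    then have "\<exists>r. strict_mono r \<and> z \<in> S \<and> (\<forall>i. \<forall>\<^sub>F n in sequentially. u (r n) i = z i)"
      by (simp only: accumulation_points_def lim mem_Collect_eq)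
    then obtain r :: "nat \<Rightarrow> nat" where r: "strict_mono r" "z \<in> S"
        "\<And>i. \<forall>\<^sub>F n in sequentially. u (r n) i = z i"
      by (elim exE conjE) (rule that, auto)
    show "z \<in> S" by fact
    fix k N
    have "\<forall>\<^sub>F n in sequentially. \<forall>i\<in>{..<k}. u (r n) i = z i"
      using r(3) by (intro eventually_ball_finite) auto
    then have "\<forall>\<^sub>F n in sequentially. n \<ge> N \<and> (\<forall>i\<in>{..<k}. u (r n) i = z i)"
      using eventually_ge_at_top eventually_conj by blast
    then obtain n where n: "n \<ge> N" "\<forall>i<k. u (r n) i = z i"
      by (auto simp: eventually_sequentially)
    then show "\<exists>n\<ge>N. \<forall>i<k. u n i = z i"
      using seq_suble[OF r(1), of n] le_trans by blast
  next
    assume z: "z \<in> S" and *: "\<forall>k N. \<exists>n\<ge>N. \<forall>i<k. u n i = z i"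
    have "\<exists>r. \<forall>n. (\<forall>i<n. u (r n) i = z i) \<and> r n < r (Suc n)"
    proof (rule dependent_nat_choice)
      show "\<exists>m'. (\<forall>i<Suc n. u m' i = z i) \<and> m < m'" for m n
        using *[rule_format, of "Suc m" "Suc n"] by (auto simp: Suc_le_eq)
    qed simp
    then obtain r where r: "\<And>n. \<forall>i<n. u (r n) i = z i" "\<And>n. r n < r (Suc n)" by blast
    have "\<forall>\<^sub>F n in sequentially. u (r n) i = z i" for i
      by (rule eventually_mono[OF eventually_gt_at_top[of i]]) (use r(1) in blast)
    moreover have "strict_mono r" using r(2) by (simp add: strict_mono_Suc_iff)
    ultimately show "z \<in> accumulation_points (top_of_set S) u"
      using z by (simp only: accumulation_points_def lim mem_Collect_eq) blast
  qed
qed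

lemma special_alpha_limit_iff:
  "z \<in> special_alpha_limit (top_of_set (subshift s)) shift omega0 \<longleftrightarrow>
     (\<exists>u. backward_orbit (top_of_set (subshift s)) shift omega0 u \<and> z \<in> subshift s \<and>
        (\<forall>k N. \<exists>n\<ge>N. \<forall>i<k. u n i = z i))"
proof -
  have "range u \<subseteq> subshift s" if "backward_orbit (top_of_set (subshift s)) shift omega0 u" for u
    using that by (auto simp: backward_orbit_def)
  then show ?thesis
    unfolding special_alpha_limit_def by (auto simp: accumulation_points_iff)
qed

section \<open>Codes of trees as accumulation points\<close>

lemma three_encode_in_subshift: "3 ## encode s T \<in> subshift s"
proof -
  have "range (encode s T) \<subseteq> {0, 1}" by (auto simp: encode_def)
  then show ?thesis by (auto simp: subshift_def)
qed

text \<open>The orbit runs backwards through \<open>omega s T y k\<close> for growing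
  \<open>k\<close>, and these words start with 3 and the first digits of the code of
  \<open>T\<close>.\<close>

lemma three_encode_in_special_alpha_limit:
  assumes "is_tree T" "infinite_branch T y"
  shows "3 ## encode s T \<in> special_alpha_limit (top_of_set (subshift s)) shift omega0"
proof -
  \<comment> \<open>The tail of \<open>omega s T y n\<close> that starts \<open>n\<close> places
    before \<open>omega0\<close>; the word is long enough because
    \<open>n \<le> block_start y n\<close>.\<close>
  define u where "u n = (shift ^^ (block_start y n - n)) (omega s T y n)" for n
  note le = strict_mono_imp_increasing[OF strict_mono_block_start]
  have T: "(T, y) \<in> tree_branch_pairs"
    using assms by (auto simp: tree_branch_pairs_def ill_founded_def)
  \<comment> \<open>Every later \<open>omega s T y k\<close> has the same tail, so neighbouring
    orbit points can be read off one common word.\<close>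
  have u: "u n = (shift ^^ (block_start y k - n)) (omega s T y k)" if "n \<le> k" for n k
  proof -
    have "block_start y n \<le> block_start y k"
      using that strict_mono_less_eq[OF strict_mono_block_start] by blast
    then have "block_start y k - n = (block_start y n - n) + (block_start y k - block_start y n)"
      using le[of n y] by simp
    then show ?thesis using shift_omega[OF that, of y s T] by (simp add: u_def funpow_add)
  qed
  have orbit: "backward_orbit (top_of_set (subshift s)) shift omega0 u"
    unfolding backward_orbit_def
  proof (intro conjI allI)
    fix n
    show "u n \<in> topspace (top_of_set (subshift s))"
      using subshiftI[OF T] by (simp add: u_def)
    have "block_start y (Suc n) - n = Suc (block_start y (Suc n) - Suc n)"
      using le[of "Suc n" y] by simp
    then show "shift (u (Suc n)) = u n" using u[of n "Suc n"] u[of "Suc n" "Suc n"] by (simp del: block_start.simps)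
  qed (simp add: u_def)
  have u_block: "u (block_start y k) = omega s T y k" for k
    using u[of "block_start y k" "block_start y k"] shift_omega[OF le[of k y], of y s T] by simp
  show ?thesis unfolding special_alpha_limit_iff
  proof (intro exI[of _ u] conjI allI)
    fix k N
    show "\<exists>n\<ge>N. \<forall>i<k. u n i = (3 ## encode s T) i"
    proof (intro exI conjI allI impI)
      show "N \<le> block_start y (k + N)" using le[of "k + N" y] by simp
      fix i assume "i < k"
      then show "u (block_start y (k + N)) i = (3 ## encode s T) i"
        by (cases i) (simp_all add: u_block omega_prefix)
    qed
  qed (fact orbit three_encode_in_subshift)+
qed

text \<open>Each prefix of the limit branch lies in all late trees \<open>Ts n\<close>, and the
  digit recording this stabilises to the digit of \<open>T\<close>.\<close>

lemma three_encode_in_special_alpha_limitD: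
  assumes s: "bij s" and "3 ## encode s T \<in> special_alpha_limit (top_of_set (subshift s)) shift omega0"
  shows "ill_founded T"
proof -
  obtain u where u: "backward_orbit (top_of_set (subshift s)) shift omega0 u"
    and *: "\<And>k N. \<exists>n\<ge>N. \<forall>i<k. u n i = (3 ## encode s T) i"
    using assms(2) unfolding special_alpha_limit_iff by blast
  \<comment> \<open>Agreement on \<open>Suc n\<close> symbols includes the leading 3 already for
    \<open>n = 0\<close>.\<close>
  have "\<exists>r. \<forall>n. (\<forall>i<Suc n. u (r n) i = (3 ## encode s T) i) \<and> r n < r (Suc n)"
  proof (rule dependent_nat_choice)
    show "\<exists>x. \<forall>i<Suc 0. u x i = (3 ## encode s T) i" using * by blast
    show "\<exists>y. (\<forall>i<Suc (Suc n). u y i = (3 ## encode s T) i) \<and> x < y" for x n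
      using *[of "Suc x" "Suc (Suc n)"] by (auto simp: Suc_le_eq)
  qed
  then obtain r where r: "\<And>n i. i \<le> n \<Longrightarrow> u (r n) i = (3 ## encode s T) i"
    and mono: "strict_mono r" by (auto simp: strict_mono_Suc_iff less_Suc_eq_le)
  have "\<exists>T y k. infinite_branch T y \<and> u (r n) = omega s T y k \<and> r n = block_start y k" for n
  proof -
    have "u (r n) 0 = 3" using r[of 0 n] by simp
    then show ?thesis by (elim backward_orbit_block[OF u]) (auto simp: tree_branch_pairs_def)
  qed
  then obtain Ts ys k where branch: "\<And>n. infinite_branch (Ts n) (ys n)"
      and ur: "\<And>n. u (r n) = omega s (Ts n) (ys n) (k n)"
      and rn: "\<And>n. r n = block_start (ys n) (k n)"
    by metis
  have ub: "u (block_start (ys n) (k n)) = omega s (Ts n) (ys n) (k n)" for n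
    using ur rn by metis
  have le: "block_start (ys m) (k m) \<le> block_start (ys n) (k n)" if "m \<le> n" for m n
    using mono that by (metis rn strict_mono_less_eq)
  \<comment> \<open>Equal block numbers would give equal times, since the block starts of the two
    pairs agree up to \<open>k m\<close>.\<close>
  have "k m < k n" if "m < n" for m n
  proof -
    have "k m \<le> k n" "block_start (ys m) (k m) = block_start (ys n) (k m)"
      using block_start_determined[OF u ub ub le, of m n "k m"] that by auto
    moreover have "r m < r n" using mono that by (simp add: strict_mono_less)
    ultimately show ?thesis using rn by (metis le_neq_implies_less less_irrefl)
  qed
  then have k: "n \<le> k n" for n
    by (intro strict_mono_imp_increasing) (simp add: strict_mono_def)
  \<comment> \<open>From the index \<open>Suc i\<close> on, the bound \<open>n \<le> k n\<close>
    guarantees that entry \<open>i\<close> is fixed.\<close>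
  define y where "y i = ys (Suc i) i" for i
  have y: "ys n i = y i" if "i < n" for n i
    using branch_determined[OF u ub ub le, of "Suc i" n i] that k[of "Suc i"] by (simp add: y_def)
  have "prefix m y \<in> T" for m
  proof -
    obtain i where i: "s i = prefix m y" using s by (metis bij_pointE)
    \<comment> \<open>Large enough for \<open>ys n\<close> to agree with \<open>y\<close> on
      \<open>m\<close> entries and for the digit at index \<open>i\<close> to be visible.\<close>
    define n where "n = Suc (i + m)"
    have "prefix m y = prefix m (ys n)" by (auto simp: subsequence_def n_def y)
    then have "s i \<in> Ts n" using branch i by (metis infinite_branch_def)
    then have "u (r n) (Suc i) = 1"
      unfolding ur using k[of n] by (simp add: omega_prefix n_def encode_def)
    moreover have "u (r n) (Suc i) = encode s T i"
      using r[of "Suc i" n] by (simp add: n_def)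
    ultimately show ?thesis using i by (metis encode_def zero_neq_one)
  qed
  then show ?thesis by (auto simp: ill_founded_def infinite_branch_def)
qed

section \<open>Polish spaces\<close>

lemma completely_metrizable_space_fun:
  assumes "completely_metrizable_space (euclidean :: 'a::topological_space topology)"
  shows "completely_metrizable_space (euclidean :: ('b::countable \<Rightarrow> 'a) topology)"
  using assms
  by (simp add: completely_metrizable_space_product_topology flip: euclidean_product_topology)

lemma completely_metrizable_space_nat: "completely_metrizable_space (euclidean :: nat topology)"
  using completely_metrizable_space_discrete_topology[of "UNIV :: nat set"]
  by (simp add: euclidean_nat)

lemma polish_closed:
  fixes S :: "'a::second_countable_topology set"
  assumes "completely_metrizable_space (euclidean :: 'a topology)" "closed S"
  shows "polish (top_of_set S)"
  unfolding polish_def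
proof
  show "completely_metrizable_space (top_of_set S)"
    using assms completely_metrizable_space_closedin closed_closedin by blast
  obtain B :: "'a set set" where B: "countable B" "topological_basis B"
    using ex_countable_basis by blast
  have "second_countable (euclidean :: 'a topology)"
    unfolding second_countable_def
  proof (intro exI conjI ballI allI impI)
    show "openin euclidean V" if "V \<in> B" for V
      using topological_basis_open[OF B(2) that] by simp
    show "\<exists>V\<in>B. x \<in> V \<and> V \<subseteq> U" if "openin euclidean U \<and> x \<in> U" for U x
      using topological_basisE[OF B(2), of U x] that by (metis open_openin)
  qed (fact B(1))
  then show "second_countable (top_of_set S)"
    by (rule second_countable_subtopology)
qed

lemma borel_sets_of_euclidean: "borel_sets_of euclidean = sets borel"
  by (simp add: borel_sets_of_def borel_def)

section \<open>Borel sets are projections of closed sets\<close>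

text \<open>For Polish spaces these are exactly the analytic sets, presented through a closed set so
  that a single sequence can code them.\<close>

definition closed_projection :: "'a::topological_space set \<Rightarrow> bool" where
  "closed_projection B \<longleftrightarrow>
     (\<exists>C :: ('a \<times> (nat \<Rightarrow> nat)) set. closed C \<and> B = {z. \<exists>y. (z, y) \<in> C})"

lemma closed_projection_closed: "closed B \<Longrightarrow> closed_projection B"
  unfolding closed_projection_def
  by (rule exI[of _ "B \<times> UNIV"]) (simp add: closed_Times)

lemma continuous_on_snd_nth:
  "continuous_on UNIV (\<lambda>p :: 'a::topological_space \<times> (nat \<Rightarrow> nat). snd p i)"
  by (rule continuous_on_product_then_coordinatewise[OF continuous_on_snd[OF continuous_on_id]])

lemma continuous_on_reindex_snd:
  "continuous_on UNIV (\<lambda>p :: 'a::topological_space \<times> (nat \<Rightarrow> nat). (fst p, \<lambda>k. snd p (h k)))"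
  by (rule continuous_on_Pair[OF continuous_on_fst[OF continuous_on_id]],
      rule continuous_on_coordinatewise_then_product, rule continuous_on_snd_nth)

text \<open>The first entry of the witness names a member of the union; the remaining entries
  witness membership in it.\<close>

lemma closed_projection_UN:
  assumes "\<And>n :: nat. closed_projection (B n)"
  shows "closed_projection (\<Union>n. B n)"
proof -
  obtain C :: "nat \<Rightarrow> ('a \<times> (nat \<Rightarrow> nat)) set" where C: "\<And>n. closed (C n)"
      "\<And>n. B n = {z. \<exists>y. (z, y) \<in> C n}"
    using assms unfolding closed_projection_def by metis
  define D where "D = {p :: 'a \<times> (nat \<Rightarrow> nat). (fst p, \<lambda>k. snd p (Suc k)) \<in> C (snd p 0)}"
  \<comment> \<open>Turns the dependence on \<open>snd p 0\<close> into a countable intersection of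
    closed conditions, since \<open>snd p 0 \<noteq> n\<close> is clopen.\<close>
  define E where "E n = ({p. snd p 0 \<noteq> n} :: ('a \<times> (nat \<Rightarrow> nat)) set)
      \<union> (\<lambda>p. (fst p, \<lambda>k. snd p (Suc k))) -` C n" for n
  have "closed ({p. snd p 0 \<noteq> n} :: ('a \<times> (nat \<Rightarrow> nat)) set)" for n
  proof -
    have "open ((\<lambda>p :: 'a \<times> (nat \<Rightarrow> nat). snd p 0) -` {n})"
      by (rule open_vimage[OF open_discrete continuous_on_snd_nth])
    then show ?thesis by (simp add: closed_def vimage_def Compl_eq)
  qed
  moreover have "closed ((\<lambda>p :: 'a \<times> (nat \<Rightarrow> nat). (fst p, \<lambda>k. snd p (Suc k))) -` C n)" for n
    by (rule closed_vimage[OF C(1) continuous_on_reindex_snd])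
  ultimately have "closed (\<Inter>n. E n)" unfolding E_def by (intro closed_INT ballI closed_Un) auto
  moreover have "(\<Inter>n. E n) = D" by (auto simp: E_def D_def)
  ultimately have "closed D" by simp
  moreover have "(\<Union>n. B n) = {z. \<exists>y. (z, y) \<in> D}"
  proof safe
    fix z n assume "z \<in> B n"
    then obtain y where "(z, y) \<in> C n" using C(2) by blast
    then have "(z, n ## y) \<in> D" by (simp add: D_def)
    then show "\<exists>y. (z, y) \<in> D" by blast
  next
    fix z y assume "(z, y) \<in> D"
    then show "z \<in> (\<Union>n. B n)" unfolding D_def C(2) by auto
  qed
  ultimately show ?thesis unfolding closed_projection_def by blast
qed

text \<open>One sequence carries the witnesses for all \<open>n\<close> at once, split by the
  pairing function.\<close>

lemma closed_projection_INT:
  assumes "\<And>n :: nat. closed_projection (B n)"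
  shows "closed_projection (\<Inter>n. B n)"
proof -
  obtain C :: "nat \<Rightarrow> ('a \<times> (nat \<Rightarrow> nat)) set" where C: "\<And>n. closed (C n)"
      "\<And>n. B n = {z. \<exists>y. (z, y) \<in> C n}"
    using assms unfolding closed_projection_def by metis
  define D where "D = (\<Inter>n. (\<lambda>p. (fst p, \<lambda>k. snd p (prod_encode (n, k)))) -` C n)"
  have "closed D"
    unfolding D_def
    by (intro closed_INT ballI closed_vimage[OF C(1) continuous_on_reindex_snd])
  moreover have "(\<Inter>n. B n) = {z. \<exists>y. (z, y) \<in> D}"
  proof safe
    fix z assume "z \<in> (\<Inter>n. B n)"
    then have "\<forall>n. \<exists>y. (z, y) \<in> C n" using C(2) by blast
    then obtain y where y: "\<And>n. (z, y n) \<in> C n" by metis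
    then have "(z, \<lambda>i. case_prod y (prod_decode i)) \<in> D" by (simp add: D_def)
    then show "\<exists>y. (z, y) \<in> D" by blast
  next
    fix z y n assume "(z, y) \<in> D"
    then show "z \<in> B n" unfolding D_def C(2) by auto
  qed
  ultimately show ?thesis unfolding closed_projection_def by blast
qed

lemma closed_projection_open:
  fixes U :: "'a::topological_space set"
  assumes "metrizable_space (euclidean :: 'a topology)" "open U"
  shows "closed_projection U"
proof -
  have "fsigma_in euclidean U"
    using assms by (simp add: open_imp_fsigma_in)
  then obtain C :: "nat \<Rightarrow> 'a set" where "\<And>n. closed (C n)" "U = (\<Union>n. C n)"
    unfolding fsigma_in_ascending by (metis closed_closedin)
  then show ?thesis by (auto intro: closed_projection_UN closed_projection_closed)
qed

text \<open>The class need not be closed under complements, so the induction treats each set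
  together with its complement.\<close>

lemma closed_projection_borel:
  fixes B :: "'a::topological_space set"
  assumes metrizable: "metrizable_space (euclidean :: 'a topology)" and "B \<in> sets borel"
  shows "closed_projection B"
proof -
  have "B \<in> sigma_sets UNIV {S. open S}" using assms(2) by (simp add: borel_def)
  then have "closed_projection B \<and> closed_projection (- B)"
  proof (induction rule: sigma_sets.induct)
    case (Basic U)
    then show ?case by (simp add: closed_projection_open[OF metrizable] closed_projection_closed closed_Compl)
  next
    case Empty
    then show ?case by (simp add: closed_projection_closed)
  next
    case (Compl U)
    then show ?case by (simp add: Compl_eq_Diff_UNIV Diff_Diff_Int)
  next
    case (Union U)
    then show ?case by (simp add: closed_projection_UN closed_projection_INT)
  qed
  then show ?thesis ..
qed

section \<open>Coding closed sets by sequences\<close>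

lemma open_prefix_eq: "open {x :: nat \<Rightarrow> nat. prefix n x = w}"
proof (cases "length w = n")
  case True
  have "prefix n x = w \<longleftrightarrow> (\<forall>k\<in>{..<n}. x (id k) \<in> {w ! k})" for x
    using True by (auto simp: list_eq_iff_nth_eq)
  moreover have "open {x :: nat \<Rightarrow> nat. \<forall>k\<in>{..<n}. x (id k) \<in> {w ! k}}"
    by (rule product_topology_basis') (auto simp: open_discrete)
  ultimately show ?thesis by simp
next
  case False
  then have "{x :: nat \<Rightarrow> nat. prefix n x = w} = {}" by auto
  then show ?thesis by (metis open_empty)
qed

text \<open>All lengths from \<open>n\<close> on are allowed so that one length can serve both
  coordinates of a pair.\<close>

lemma open_contains_prefix_nbhd:
  fixes U :: "(nat \<Rightarrow> nat) set"
  assumes "open U" "x \<in> U"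
  obtains n where "\<And>m z. n \<le> m \<Longrightarrow> prefix m z = prefix m x \<Longrightarrow> z \<in> U"
proof -
  obtain X where X: "x \<in> Pi\<^sub>E UNIV X" "finite {i. X i \<noteq> UNIV}" "Pi\<^sub>E UNIV X \<subseteq> U"
    using product_topology_open_contains_basis[of "\<lambda>_. euclidean" UNIV U x] assms
    by (auto simp: open_fun_def)
  obtain n where n: "\<And>i. X i \<noteq> UNIV \<Longrightarrow> i < n"
    using finite_nat_set_iff_bounded X(2) by auto
  show thesis
  proof (rule that)
    fix m z assume "n \<le> m" "prefix m z = prefix m x"
    then have eq: "z i = x i" if "i < n" for i
      using that by (metis add_0 diff_zero less_le_trans subsequence_nth)
    have "z i \<in> X i" for i
    proof (cases "X i = UNIV")
      case False
      then show ?thesis using X(1) n eq by (metis PiE_mem UNIV_I)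
    qed simp
    then show "z \<in> U" using X(3) by auto
  qed
qed

text \<open>The code marks the pairs of words that are initial segments of a point of
  \<open>C\<close>. As \<open>C\<close> is closed, a point outside it has a pair of prefixes that no
  point of \<open>C\<close> shares, and this pair is unmarked.\<close>

lemma closed_code:
  fixes C :: "((nat \<Rightarrow> nat) \<times> (nat \<Rightarrow> nat)) set"
  assumes "closed C"
  obtains c :: "nat \<Rightarrow> nat" where
    "\<And>z y. (z, y) \<in> C \<longleftrightarrow> (\<forall>n. c (to_nat (prefix n z, prefix n y)) = 1)"
proof -
  define P where "P p \<longleftrightarrow> (\<exists>(z, y) \<in> C. \<exists>n. p = (prefix n z, prefix n y))" for p
  define c :: "nat \<Rightarrow> nat" where "c i = (if P (from_nat i) then 1 else 0)" for i
  show thesis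
  proof (rule that)
    fix z y
    have "(z, y) \<in> C" if P: "\<And>n. P (prefix n z, prefix n y)"
    proof (rule ccontr)
      assume "(z, y) \<notin> C"
      then obtain U V where UV: "open U" "open V" "z \<in> U" "y \<in> V" "U \<times> V \<subseteq> - C"
        using assms by (elim open_prod_elim[of "- C" "(z, y)", OF open_Compl]) auto
      obtain n where n: "\<And>m z'. n \<le> m \<Longrightarrow> prefix m z' = prefix m z \<Longrightarrow> z' \<in> U"
        using open_contains_prefix_nbhd UV by metis
      obtain k where k: "\<And>m y'. k \<le> m \<Longrightarrow> prefix m y' = prefix m y \<Longrightarrow> y' \<in> V"
        using open_contains_prefix_nbhd UV by metis
      obtain z' y' m where zy: "(z', y') \<in> C"
          "prefix (max n k) z = prefix m z'" "prefix (max n k) y = prefix m y'"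
        using P[of "max n k"] unfolding P_def by auto
      then have "m = max n k" by (metis diff_zero subsequence_length)
      then have "z' \<in> U" "y' \<in> V" using n[of m z'] k[of m y'] zy by simp_all
      then show False using UV(5) zy(1) by blast
    qed
    then show "(z, y) \<in> C \<longleftrightarrow> (\<forall>n. c (to_nat (prefix n z, prefix n y)) = 1)"
      unfolding c_def P_def by (auto split: if_splits)
  qed
qed

section \<open>A diagonal tree\<close>

text \<open>With \<open>c\<close> read as a code in the sense of \<open>closed_code\<close>, the
  branches are the \<open>y\<close> for which \<open>(c, y)\<close> lies in the coded set. Testing
  all \<open>m \<le> length t\<close> makes the set closed under initial segments.\<close>

definition diagonal_tree :: "(nat \<Rightarrow> nat) \<Rightarrow> nat list set" where
  "diagonal_tree c = {t. \<forall>m\<le>length t. c (to_nat (prefix m c, take m t)) = 1}"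

lemma is_tree_diagonal_tree: "is_tree (diagonal_tree c)"
  by (auto simp: is_tree_def diagonal_tree_def min_def)

lemma infinite_branch_diagonal_tree:
  "infinite_branch (diagonal_tree c) y \<longleftrightarrow> (\<forall>n. c (to_nat (prefix n c, prefix n y)) = 1)"
  by (auto simp: infinite_branch_def diagonal_tree_def min_def)

lemma diagonal_not_borel: "{c. ill_founded (diagonal_tree c)} \<notin> sets borel"
proof
  assume "{c. ill_founded (diagonal_tree c)} \<in> sets borel"
  then have "closed_projection (- {c. ill_founded (diagonal_tree c)})"
    by (intro closed_projection_borel borel_comp completely_metrizable_imp_metrizable_space
        completely_metrizable_space_fun completely_metrizable_space_nat)
  then obtain C :: "((nat \<Rightarrow> nat) \<times> (nat \<Rightarrow> nat)) set" where "closed C"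
    and C: "- {c. ill_founded (diagonal_tree c)} = {z. \<exists>y. (z, y) \<in> C}"
    unfolding closed_projection_def by blast
  obtain c :: "nat \<Rightarrow> nat"
    where c: "\<And>z y. (z, y) \<in> C \<longleftrightarrow> (\<forall>n. c (to_nat (prefix n z, prefix n y)) = 1)"
    by (rule closed_code[OF \<open>closed C\<close>]) (rule that)
  \<comment> \<open>The code of the complement is tested on itself.\<close>
  have "ill_founded (diagonal_tree c) \<longleftrightarrow> (\<exists>y. (c, y) \<in> C)"
    by (simp add: ill_founded_def infinite_branch_diagonal_tree c)
  also have "\<dots> \<longleftrightarrow> \<not> ill_founded (diagonal_tree c)"
    using arg_cong[OF C, of "\<lambda>X. c \<in> X"] by simp
  finally show False by blast
qed

section \<open>Continuity of the reduction\<close>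

text \<open>The position at which \<open>c\<close> is read depends on \<open>c\<close>, but only
  through a finite prefix; it is constant on each piece of the union over all prefixes.\<close>

lemma open_diagonal_value: "open {c :: nat \<Rightarrow> nat. c (g (prefix m c)) \<in> A}"
proof -
  have "{c. c (g (prefix m c)) \<in> A} = (\<Union>p. {c. prefix m c = p} \<inter> {c. c (g p) \<in> A})" by auto
  moreover have "open {c :: nat \<Rightarrow> nat. c i \<in> A}" for i
  proof -
    have "open ((\<lambda>c :: nat \<Rightarrow> nat. c i) -` A)"
      by (rule open_vimage[OF open_discrete continuous_on_product_coordinates])
    then show ?thesis by (simp add: vimage_def)
  qed
  ultimately show ?thesis by (auto intro!: open_UN open_Int open_prefix_eq)
qed

text \<open>Finitely many values of \<open>c\<close> decide whether a given word belongs to the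
  tree, so membership is a clopen condition on \<open>c\<close>.\<close>

lemma continuous_encode_diagonal_tree:
  "continuous_on UNIV (\<lambda>c. 3 ## encode s (diagonal_tree c))"
proof (rule continuous_on_coordinatewise_then_product)
  fix i
  show "continuous_on UNIV (\<lambda>c. (3 ## encode s (diagonal_tree c)) i)"
  proof (cases i)
    case (Suc j)
    note val = open_diagonal_value[where g = "\<lambda>p. to_nat (p, take m (s j))" for m]
    have "{c. s j \<in> diagonal_tree c} =
        (\<Inter>m\<in>{..length (s j)}. {c. c (to_nat (prefix m c, take m (s j))) \<in> {1}})"
      by (auto simp: diagonal_tree_def)
    also have "open \<dots>" by (intro open_INT finite_atMost ballI val)
    finally have 1: "open {c. s j \<in> diagonal_tree c}" .
    have "{c. s j \<notin> diagonal_tree c} =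
        (\<Union>m\<in>{..length (s j)}. {c. c (to_nat (prefix m c, take m (s j))) \<in> - {1}})"
      by (auto simp: diagonal_tree_def)
    also have "open \<dots>" by (intro open_UN ballI val)
    finally have 2: "open {c. s j \<notin> diagonal_tree c}" .
    have "open ((\<lambda>c. encode s (diagonal_tree c) j) -` A)" for A
    proof -
      have "(\<lambda>c. encode s (diagonal_tree c) j) -` A =
          (if 1 \<in> A then {c. s j \<in> diagonal_tree c} else {}) \<union>
          (if 0 \<in> A then {c. s j \<notin> diagonal_tree c} else {})"
        by (auto simp: encode_def split: if_splits)
      then show ?thesis using 1 2 by (simp add: open_Un)
    qed
    then show ?thesis by (simp add: Suc continuous_on_open_vimage)
  qed simp
qed

section \<open>Complexity of the special alpha-limit set\<close>

text \<open>The quantifier over orbits becomes a projection; the Polish space is \<open>S\<close>, a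
  closed subset of a countable product.\<close>

lemma analytic_special_alpha_limit:
  "analytic_in (top_of_set (subshift s)) (special_alpha_limit (top_of_set (subshift s)) shift omega0)"
proof -
  define S where "S = {v :: nat \<Rightarrow> nat \<Rightarrow> nat. \<forall>n. v n \<in> subshift s}"
  \<comment> \<open>v 0 is the accumulation point and v (n + 1) the n-th point of the backward orbit\<close>
  define A where "A = {v :: nat \<Rightarrow> nat \<Rightarrow> nat. (\<forall>i. v 1 i = omega0 i) \<and>
      (\<forall>n i. v (n + 2) (i + 1) = v (n + 1) i) \<and> (\<forall>k N. \<exists>n\<ge>N. \<forall>i<k. v (n + 1) i = v 0 i)}"
  have coord [measurable]: "(\<lambda>v :: nat \<Rightarrow> nat \<Rightarrow> nat. v n i) \<in> borel \<rightarrow>\<^sub>M count_space UNIV" for n i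
  proof (rule measurableI)
    fix B :: "nat set"
    have "continuous_on UNIV (\<lambda>v :: nat \<Rightarrow> nat \<Rightarrow> nat. v n i)"
      by (rule continuous_on_product_then_coordinatewise) (rule continuous_on_product_coordinates)
    then have "open ((\<lambda>v :: nat \<Rightarrow> nat \<Rightarrow> nat. v n i) -` B)"
      by (rule open_vimage[OF open_discrete])
    then show "(\<lambda>v :: nat \<Rightarrow> nat \<Rightarrow> nat. v n i) -` B \<inter> space borel \<in> sets borel" by simp
  qed simp
  \<comment> \<open>All quantifiers range over natural numbers, so \<open>A\<close> arises from
    coordinate conditions by countable unions and intersections.\<close>
  have "A \<in> sets borel"
    unfolding A_def by measurable
  then have A: "S \<inter> A \<in> borel_sets_of (top_of_set S)"
    using borel_sets_of_vimage[of "top_of_set S" euclidean id A]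
    by (simp add: borel_sets_of_euclidean)
  have "S = (\<Inter>n. (\<lambda>v. v n) -` subshift s)" by (auto simp: S_def)
  also have "closed \<dots>"
    by (intro closed_INT ballI closed_vimage closed_subshift continuous_on_product_coordinates)
  finally have "polish (top_of_set S)"
    by (intro polish_closed completely_metrizable_space_fun completely_metrizable_space_nat)
  moreover have "continuous_map (top_of_set S) (top_of_set (subshift s)) (\<lambda>v. v 0)"
    by (auto simp: S_def intro!: continuous_on_subset[OF continuous_on_product_coordinates])
  ultimately have "analytic_in (top_of_set (subshift s)) ((\<lambda>v. v 0) ` (S \<inter> A))"
    using analytic_inI A by blast
  also have "(\<lambda>v. v 0) ` (S \<inter> A) = special_alpha_limit (top_of_set (subshift s)) shift omega0"
  proof safe
    fix v assume "v \<in> S" "v \<in> A"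
    then show "v 0 \<in> special_alpha_limit (top_of_set (subshift s)) shift omega0"
      unfolding special_alpha_limit_iff
      by (intro exI[of _ "\<lambda>n. v (n + 1)"])
        (auto simp: S_def A_def backward_orbit_def shift_def fun_eq_iff)
  next
    fix z assume "z \<in> special_alpha_limit (top_of_set (subshift s)) shift omega0"
    then obtain u where u: "backward_orbit (top_of_set (subshift s)) shift omega0 u"
        "z \<in> subshift s" "\<forall>k N. \<exists>n\<ge>N. \<forall>i<k. u n i = z i"
      unfolding special_alpha_limit_iff by blast
    have sh: "u (Suc n) (Suc i) = u n i" for n i
      using u(1) by (auto simp: backward_orbit_def shift_def fun_eq_iff)
    define v where "v = z ## u"
    have "v \<in> S" unfolding S_def v_def
    proof safe
      show "(z ## u) n \<in> subshift s" for n
        using u by (cases n) (auto simp: backward_orbit_def)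
    qed
    moreover have "v \<in> A"
      using u(1,3) sh by (auto simp: A_def v_def backward_orbit_def)
    ultimately show "z \<in> (\<lambda>v. v 0) ` (S \<inter> A)"
      by (intro image_eqI[of _ _ v]) (auto simp: v_def)
  qed
  finally show ?thesis .
qed

text \<open>Sending \<open>c\<close> to \<open>3 ## encode s (diagonal_tree c)\<close> is a
  continuous reduction of the non-Borel set of \<open>diagonal_not_borel\<close> to the limit
  set.\<close>

lemma special_alpha_limit_not_borel:
  assumes "bij s"
  shows "special_alpha_limit (top_of_set (subshift s)) shift omega0
    \<notin> borel_sets_of (top_of_set (subshift s))" (is "?L \<notin> _")
proof
  assume "?L \<in> borel_sets_of (top_of_set (subshift s))"
  moreover have "continuous_map euclidean (top_of_set (subshift s))
      (\<lambda>c. 3 ## encode s (diagonal_tree c))"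
    by (simp add: continuous_map_in_subtopology image_subset_iff three_encode_in_subshift
        continuous_encode_diagonal_tree)
  ultimately have "(\<lambda>c. 3 ## encode s (diagonal_tree c)) -` ?L \<in> sets borel"
    using borel_sets_of_vimage by (fastforce simp: borel_sets_of_euclidean)
  moreover have "3 ## encode s (diagonal_tree c) \<in> ?L \<longleftrightarrow> ill_founded (diagonal_tree c)" for c
    using three_encode_in_special_alpha_limit[OF is_tree_diagonal_tree]
      three_encode_in_special_alpha_limitD[OF assms] unfolding ill_founded_def by blast
  ultimately show False using diagonal_not_borel by (simp add: vimage_def)
qed

theorem theorem4:
  fixes s :: "nat \<Rightarrow> nat list"
  assumes "bij s"
  shows "Sigma11_complete (top_of_set (subshift s))
           (special_alpha_limit (top_of_set (subshift s)) shift omega0)"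
  unfolding Sigma11_complete_def
  using analytic_special_alpha_limit special_alpha_limit_not_borel[OF assms] by blast

end
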